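(* Let $q$ be a prime power, $m\geq 1$, and let $n = \ell N$ be a sum-rank length partition with equal sublengths $N = n_1 = n_2 = \cdots = n_\ell$. A proper sum-rank Hamming code $\mathcal{C} \subseteq \mathbb{F}_{q^m}^n$ with redundancy $r = n - \dim(\mathcal{C})$ is a linear code of redundancy $r$ capable of correcting a single sum-rank error in an $(\mathbf{m}\times\mathbf{n})$-multishot matrix-multiplicative channel with $m = m_1 = m_2 = \cdots = m_\ell$ and $N = n_1 = n_2 = \cdots = n_\ell$ for the largest number of shots $\ell$. That is, $\mathcal{C}$ can coherently correct $t=1$ sum-rank errors and $\rho = 0$ sum-rank erasures, and for no $\ell' > \ell$ does there exist a linear code in $\mathbb{F}_{q^m}^{\ell' N}$ of redundancy $r$ (with $\ell'$ blocks of length $N$) that can coherently correct $1$ sum-rank error and $0$ sum-rank erasures.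
   Context: Linear codes are $\mathbb{F}_{q^m}$-linear subspaces. Fix an ordered basis $\mathcal{A}$ of $\mathbb{F}_{q^m}$ over $\mathbb{F}_q$, and for $\mathbf{c}\in\mathbb{F}_{q^m}^s$ let $M_{\mathcal{A}}(\mathbf{c}) \in \mathbb{F}_q^{m\times s}$ be the matrix whose $j$th column is the coordinate vector of $c_j$ in the basis $\mathcal{A}$. For $\mathbf{c} = (\mathbf{c}^{(1)}, \ldots, \mathbf{c}^{(\ell)})$ split into blocks, $\mathrm{wt}_{SR}(\mathbf{c}) = \sum_{i=1}^\ell \mathrm{Rk}(M_{\mathcal{A}}(\mathbf{c}^{(i)}))$, and $\mathrm{d}_{SR}(\mathcal{C}) = \min\{\mathrm{wt}_{SR}(\mathbf{c}) \mid \mathbf{c}\in\mathcal{C}\setminus\{\mathbf{0}\}\}$. Proper sum-rank Hamming code (for fixed $q$, $m$, redundancy $r$): for a partition $n = \ell N$ into $\ell$ blocks of equal length $N$, a linear code $\mathcal{C}\subseteq\mathbb{F}_{q^m}^n$ with $\mathrm{d}_{SR}(\mathcal{C})\geq 3$ and $r = n - \dim(\mathcal{C})$ such that there is no linear code $\mathcal{C}'\subseteq\mathbb{F}_{q^m}^{n'}$ with $\mathrm{d}_{SR}(\mathcal{C}')\geq 3$ and $r = n'-\dim(\mathcal{C}')$ for a partition $n' = \ell' N$ into blocks of length $N$ with $\ell'>\ell$. Multishot matrix-multiplicative channel over $\mathbb{F}_q$ with $\ell$ shots: the input is $(X_1,\ldots,X_\ell)$ with $X_i\in\mathbb{F}_q^{m\times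 n_i}$, and the output is $(X_1A_1+E_1,\ldots,X_\ell A_\ell+E_\ell)$ for some transfer matrices $A_i\in\mathbb{F}_q^{n_i\times P_i}$ and error matrices $E_i\in\mathbb{F}_q^{m\times P_i}$, for some positive integers $P_1,\ldots,P_\ell$. The number of sum-rank errors is $\sum_i\mathrm{Rk}(E_i)$ and the number of sum-rank erasures is $\sum_i(n_i-\mathrm{Rk}(A_i))$. Sequences of matrices with $m$ rows are identified with vectors over $\mathbb{F}_{q^m}$ via $M_{\mathcal{A}}$. A $k$-dimensional linear code $\mathcal{C}\subseteq\mathbb{F}_{q^m}^n$ can coherently correct $t$ sum-rank errors and $\rho$ sum-rank erasures if, for all positive integers $P_1,\ldots,P_\ell$ and all $A_i\in\mathbb{F}_q^{n_i\times P_i}$ with $\sum_{i=1}^\ell\mathrm{Rk}(A_i)\geq n-\rho$, there is a decoder $D:\mathbb{F}_{q^m}^{P}\to\mathbb{F}_{q^m}^k$, $P = P_1+\cdots+P_\ell$ (possibly depending on $A_1,\ldots,A_\ell$), such that $D(\mathbf{c}^{(1)}A_1+\mathbf{e}^{(1)},\ldots,\mathbf{c}^{(\ell)}A_\ell+\mathbf{e}^{(\ell)}) = \mathbf{x}$ for all $\mathbf{x}\in\mathbb{F}_{q^m}^k$, where $\mathbf{c}$ is the encoding of $\mathbf{x}$ by a fixed generator matrix of $\mathcal{C}$, and for all $\mathbf{e} = (\mathbf{e}^{(1)},\ldots,\mathbf{e}^{(\ell)})\in\mathbb{F}_{q^m}^{P}$, $\mathbf{e}^{(i)}\in\mathbb{F}_{q^m}^{P_i}$,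 with $\mathrm{wt}_{SR}(\mathbf{e})\leq t$. *)

theory Defs
  imports
    "Jordan_Normal_Form.DL_Rank"
    "HOL-Library.Extended_Nat"
begin

text \<open>
  The field extension is a homomorphism \<open>emb\<close> from the ground field \<open>'q\<close> to the extension
  field \<open>'k\<close>. Vectors and matrices are those of \<open>Jordan_Normal_Form\<close>; code words are row vectors,
  so multiplication by a matrix from the right is multiplication by its transpose from the left.
\<close>

definition ordered_basis :: "('q::field \<Rightarrow> 'k::field) \<Rightarrow> 'k list \<Rightarrow> bool" where
  "ordered_basis emb bs \<longleftrightarrow>
     distinct bs \<and>
     \<not> Modules.module.dependent (\<lambda>a x. emb a * x) (set bs) \<and>
     Modules.module.span (\<lambda>a x. emb a * x) (set bs) = UNIV"

definition coord_mat :: "('q::field \<Rightarrow> 'k::field) \<Rightarrow> 'k list \<Rightarrow> 'k vec \<Rightarrow> 'q mat" where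
  "coord_mat emb bs c = mat (length bs) (dim_vec c)
     (\<lambda>(i, j). Modules.module.representation (\<lambda>a x. emb a * x) (set bs) (c $ j) (bs ! i))"

text \<open>
  A sum-rank length partition \<open>n = n\<^sub>1 + \<dots> + n\<^sub>\<ell>\<close> is the list \<open>ns\<close> of its parts; blocks are
  counted from 0.
\<close>

definition block :: "nat list \<Rightarrow> nat \<Rightarrow> 'k vec \<Rightarrow> 'k vec" where
  "block ns i c = vec (ns ! i) (\<lambda>j. c $ (sum_list (take i ns) + j))"

definition wt_SR :: "('q::field \<Rightarrow> 'k::field) \<Rightarrow> 'k list \<Rightarrow> nat list \<Rightarrow> 'k vec \<Rightarrow> nat" where
  "wt_SR emb bs ns c =
     (\<Sum>i<length ns. vec_space.rank (length bs) (coord_mat emb bs (block ns i c)))"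

text \<open>The value is \<open>\<infinity>\<close> for the zero code, which has no nonzero code word.\<close>

definition d_SR :: "('q::field \<Rightarrow> 'k::field) \<Rightarrow> 'k list \<Rightarrow> nat list \<Rightarrow> 'k vec set \<Rightarrow> enat" where
  "d_SR emb bs ns C = (INF c \<in> C - {0\<^sub>v (sum_list ns)}. enat (wt_SR emb bs ns c))"

definition linear_code :: "nat \<Rightarrow> 'k::field vec set \<Rightarrow> bool" where
  "linear_code n C \<longleftrightarrow> VectorSpace.subspace class_ring C (module_vec TYPE('k) n)"

definition code_dim :: "nat \<Rightarrow> 'k::field vec set \<Rightarrow> nat" where
  "code_dim n C = vectorspace.dim class_ring ((module_vec TYPE('k) n)\<lparr>carrier := C\<rparr>)"

definition redundancy :: "nat \<Rightarrow> 'k::field vec set \<Rightarrow> nat" where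
  "redundancy n C = n - code_dim n C"

definition proper_SR_Hamming ::
    "('q::field \<Rightarrow> 'k::field) \<Rightarrow> 'k list \<Rightarrow> nat \<Rightarrow> nat \<Rightarrow> nat \<Rightarrow> 'k vec set \<Rightarrow> bool" where
  "proper_SR_Hamming emb bs N r l C \<longleftrightarrow>
     linear_code (l * N) C \<and> d_SR emb bs (replicate l N) C \<ge> 3 \<and> r = redundancy (l * N) C \<and>
     \<not> (\<exists>l' C'. l' > l \<and> linear_code (l' * N) C' \<and> d_SR emb bs (replicate l' N) C' \<ge> 3 \<and>
          r = redundancy (l' * N) C')"

definition shot_output ::
    "('q::field \<Rightarrow> 'k::field) \<Rightarrow> 'q mat \<Rightarrow> 'k vec \<Rightarrow> 'k vec \<Rightarrow> 'k vec" where
  "shot_output emb A c e = (map_mat emb A)\<^sup>T *\<^sub>v c + e"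

definition channel_output ::
    "('q::field \<Rightarrow> 'k::field) \<Rightarrow> nat list \<Rightarrow> nat list \<Rightarrow> 'q mat list \<Rightarrow> 'k vec \<Rightarrow> 'k vec \<Rightarrow> 'k vec" where
  "channel_output emb ns Ps As c e =
     foldr (@\<^sub>v)
       (map (\<lambda>i. shot_output emb (As ! i) (block ns i c) (block Ps i e)) [0..<length ns]) vNil"

definition generator_matrix :: "nat \<Rightarrow> 'k::field vec set \<Rightarrow> 'k mat \<Rightarrow> bool" where
  "generator_matrix n C G \<longleftrightarrow>
     G \<in> carrier_mat (code_dim n C) n \<and> vec_space.row_space n G = C"

definition coherently_corrects ::
    "('q::field \<Rightarrow> 'k::field) \<Rightarrow> 'k list \<Rightarrow> nat list \<Rightarrow> 'k vec set \<Rightarrow> nat \<Rightarrow> nat \<Rightarrow> bool" where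
  "coherently_corrects emb bs ns C t \<rho> \<longleftrightarrow>
     (let n = sum_list ns; k = code_dim n C in
      \<exists>G. generator_matrix n C G \<and>
        (\<forall>Ps As. length Ps = length ns \<and> length As = length ns \<and>
            (\<forall>i<length ns. Ps ! i > 0 \<and> As ! i \<in> carrier_mat (ns ! i) (Ps ! i)) \<and>
            (\<Sum>i<length ns. vec_space.rank (ns ! i) (As ! i)) \<ge> n - \<rho> \<longrightarrow>
          (\<exists>D \<in> carrier_vec (sum_list Ps) \<rightarrow> carrier_vec k.
            \<forall>x \<in> carrier_vec k. \<forall>e \<in> carrier_vec (sum_list Ps).
              wt_SR emb bs Ps e \<le> t \<longrightarrow>
              D (channel_output emb ns Ps As (G\<^sup>T *\<^sub>v x) e) = x)))"

text \<open>
  Under the identification of vectors over \<open>'k\<close> with matrices over \<open>'q\<close> given by the coordinate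
  matrix, each shot is the matrix-multiplicative channel \<open>X \<mapsto> X A + E\<close>.
\<close>

lemma coord_mat_shot_output:
  fixes emb :: "'q::field \<Rightarrow> 'k::field"
  assumes hom: "field_hom emb" and bas: "ordered_basis emb bs"
    and A: "A \<in> carrier_mat n P" and c: "c \<in> carrier_vec n" and e: "e \<in> carrier_vec P"
  shows "coord_mat emb bs (shot_output emb A c e) = coord_mat emb bs c * A + coord_mat emb bs e"
proof -
  interpret E: field_hom emb by (rule hom)
  interpret V: Vector_Spaces.vector_space "\<lambda>(a::'q) (x::'k). emb a * x"
    by unfold_locales (simp_all add: algebra_simps E.hom_add E.hom_mult)
  have ind: "V.independent (set bs)" and sp: "V.span (set bs) = UNIV"
    using bas unfolding ordered_basis_def by auto
  let ?R = "V.representation (set bs)"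
  have add: "?R (x + y) b = ?R x b + ?R y b" for x y b
    using V.representation_add[OF ind] sp by simp
  have scl: "?R (emb a * x) b = a * ?R x b" for a x b
    using V.representation_scale[OF ind] sp by simp
  have sm: "?R (sum f S) b = (\<Sum>i\<in>S. ?R (f i) b)" for f :: "nat \<Rightarrow> 'k" and S b
    using V.representation_sum[OF ind, of S f] sp by simp
  show ?thesis
  proof (rule eq_matI)
    fix i j
    assume "i < dim_row (coord_mat emb bs c * A + coord_mat emb bs e)"
      and "j < dim_col (coord_mat emb bs c * A + coord_mat emb bs e)"
    then have i: "i < length bs" and j: "j < P"
      using e by (auto simp: coord_mat_def)
    have "shot_output emb A c e $ j = (\<Sum>s = 0..<n. emb (A $$ (s, j)) * c $ s) + e $ j"
      using A c e j unfolding shot_output_def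
      by (auto simp: scalar_prod_def intro!: sum.cong)
    then have "?R (shot_output emb A c e $ j) (bs ! i) =
        (\<Sum>s = 0..<n. A $$ (s, j) * ?R (c $ s) (bs ! i)) + ?R (e $ j) (bs ! i)"
      by (simp add: add sm scl)
    then show "coord_mat emb bs (shot_output emb A c e) $$ (i, j) =
        (coord_mat emb bs c * A + coord_mat emb bs e) $$ (i, j)"
      using A c e i j
      by (simp add: coord_mat_def shot_output_def scalar_prod_def mult.commute[of "A $$ _"])
  qed (use A c e in \<open>auto simp: coord_mat_def shot_output_def\<close>)
qed

end

theory Submission
  imports Defs
begin

text \<open>
  A linear code coherently corrects \<open>t\<close> errors and no erasures if and only if its minimum sum-rank
  distance is at least \<open>2t + 1\<close>; the theorem is the case \<open>t = 1\<close>, applied to every number of shots.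
  Without erasures all transfer matrices have full row rank, so two messages with the same output
  have code words whose difference weighs at most as much as the difference of the errors, that
  is, at most \<open>2t\<close>. Conversely, for the channel with identity transfer matrices, a nonzero
  code word of weight at most \<open>2t\<close> is a difference of two errors of weight at most \<open>t\<close>, because
  a rank factorization splits off one unit of rank at a time.
\<close>

section \<open>Rank factorization\<close>

text \<open>Linearly independent subsets of \<open>W\<close> have at most \<open>n\<close> elements,
  so a maximal one exists, and maximality forces it to span \<open>W\<close>. It is given as a list
  so that it can serve as the columns or rows of a matrix.\<close>

lemma (in vec_space) subspace_basis_list:
  assumes W: "VectorSpace.subspace class_ring W V"
  obtains ws where "distinct ws" and "set ws \<subseteq> W" and "set ws \<subseteq> carrier_vec n"
    and "lin_indpt (set ws)" and "span (set ws) = W"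
    and "length ws = vectorspace.dim class_ring (V\<lparr>carrier := W\<rparr>)"
proof -
  have sub: "submodule class_ring W V" using W by (simp add: subspace_def)
  then have Wc: "W \<subseteq> carrier_vec n" using submodule.subset[OF sub] by simp
  have "\<exists>U. finite U \<and> maximal U (\<lambda>T. T \<subseteq> W \<and> lin_indpt T)"
  proof (rule maximal_exists)
    fix T assume "T \<subseteq> W \<and> lin_indpt T"
    then show "finite T \<and> card T \<le> dim" using li_le_dim[of T] Wc by auto
  next
    show "{} \<subseteq> W \<and> lin_indpt {}" by (simp add: lin_dep_def)
  qed
  then obtain U where fin: "finite U" and mx: "maximal U (\<lambda>T. T \<subseteq> W \<and> lin_indpt T)" by blast
  have U: "U \<subseteq> W" "lin_indpt U" using mx by (auto simp: maximal_def)
  have Uc: "U \<subseteq> carrier_vec n" using U Wc by blast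
  have "span U \<subseteq> W" using span_is_subset[OF U(1) sub] .
  moreover have "W \<subseteq> span U"
  proof
    fix w assume w: "w \<in> W"
    show "w \<in> span U"
    proof (rule ccontr)
      assume nin: "w \<notin> span U"
      have "w \<notin> U" using nin span_mem Uc by auto
      then have "lin_indpt (U \<union> {w})" using lin_dep_iff_in_span[OF _ U(2), of w] nin Uc w Wc by auto
      then show False using mx w U \<open>w \<notin> U\<close>
        unfolding maximal_def
        by (metis Un_insert_right insertI1 insert_subset sup_bot_right subset_insertI)
    qed
  qed
  ultimately have sp: "span U = W" by blast
  \<comment> \<open>\<open>dim_span\<close> asks for a subset that is maximal within the spanning
    set itself; here the two coincide.\<close>
  have "maximal U (\<lambda>T. T \<subseteq> U \<and> lin_indpt T)" using U by (auto simp: maximal_def)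
  from dim_span[OF _ fin this] Uc have dim: "vectorspace.dim class_ring (V\<lparr>carrier := W\<rparr>) = card U"
    by (simp add: sp)
  obtain ws where "set ws = U" "distinct ws" using finite_distinct_list[OF fin] by blast
  with U Uc sp dim show thesis by (intro that[of ws]) (auto simp: distinct_card)
qed

text \<open>Applying \<open>B * K\<close> to a vector is applying \<open>B\<close> to its image
  under \<open>K\<close>, which gives a combination of the columns of \<open>B\<close>.\<close>

lemma (in vec_space) span_cols_mult_subset:
  assumes B: "B \<in> carrier_mat n k" and K: "K \<in> carrier_mat k nc"
  shows "span (set (cols (B * K))) \<subseteq> span (set (cols B))"
proof -
  have "w \<in> col_space B" if "w \<in> col_space (B * K)" for w
    using that B K unfolding col_space_eq[OF B] col_space_eq[OF mult_carrier_mat[OF B K]]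
    by (auto simp: assoc_mult_mat_vec[OF B K] intro!: bexI[of _ "K *\<^sub>v _"])
  then show ?thesis by (auto simp: col_space_def)
qed

lemma (in vec_space) rank_mult_le:
  assumes B: "B \<in> carrier_mat n k" and K: "K \<in> carrier_mat k nc"
  shows "rank (B * K) \<le> rank B"
proof -
  have BK: "B * K \<in> carrier_mat n nc" using B K by simp
  have c: "set (cols B) \<subseteq> carrier_vec n" "set (cols (B * K)) \<subseteq> carrier_vec n"
    using B BK cols_dim by blast+
  \<comment> \<open>The larger span is taken as the ambient space, so that monotonicity of the
    dimension applies to the smaller one.\<close>
  have "VectorSpace.subspace class_ring (span (set (cols (B * K)))) (vs (span (set (cols B))))"
    using c span_cols_mult_subset[OF B K] by (intro nested_subspaces span_is_subspace) auto
  then show ?thesis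
    unfolding rank_def
    using vectorspace.subspace_dim[OF subspace_is_vs[OF span_is_subspace]] c
      fin_dim_span_cols[OF B] fin_dim_span_cols[OF BK] by simp
qed

text \<open>Coefficients that express the columns of \<open>A\<close> through \<open>ws\<close> form
  the columns of \<open>K\<close>. It is used with a basis of a column space and with the columns of
  a matrix of full row rank.\<close>

lemma (in vec_space) mat_factor_through_basis:
  assumes A: "A \<in> carrier_mat n nc" and ws: "set ws \<subseteq> carrier_vec n"
    and sub: "set (cols A) \<subseteq> span (set ws)"
  obtains K where "K \<in> carrier_mat (length ws) nc" and "A = mat_of_cols n ws * K"
proof -
  let ?B = "mat_of_cols n ws"
  have B: "?B \<in> carrier_mat n (length ws)" by simp
  have "\<exists>y \<in> carrier_vec (length ws). ?B *\<^sub>v y = col A j" if "j < nc" for j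
  proof -
    have "col A j \<in> set (cols A)" using that A by (metis carrier_matD(2) cols_length cols_nth nth_mem)
    then have "col A j \<in> col_space ?B" using sub ws by (auto simp: col_space_def)
    then show ?thesis unfolding col_space_eq[OF B] by auto
  qed
  then obtain y where y: "\<And>j. j < nc \<Longrightarrow> y j \<in> carrier_vec (length ws) \<and> ?B *\<^sub>v y j = col A j"
    by metis
  define K where "K = mat_of_cols (length ws) (map y [0..<nc])"
  have K: "K \<in> carrier_mat (length ws) nc"
    using mat_of_cols_carrier(1)[of "length ws" "map y [0..<nc]"] by (simp add: K_def)
  have "A = ?B * K"
  proof (rule mat_col_eqI)
    fix j assume "j < dim_col (?B * K)"
    then have j: "j < nc" using K by auto
    have "col K j = y j" using j y[OF j] by (auto simp: K_def col_mat_of_cols)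
    then show "col A j = col (?B * K) j" using y[OF j] col_mult2[OF B K j] by simp
  qed (use A K in auto)
  with K show thesis by (rule that)
qed

text \<open>A basis of the column space as left factor makes the inner dimension equal to the
  rank.\<close>

lemma (in vec_space) rank_factorization:
  assumes A: "A \<in> carrier_mat n nc"
  obtains B K where "B \<in> carrier_mat n (rank A)" and "K \<in> carrier_mat (rank A) nc" and "A = B * K"
proof -
  have c: "set (cols A) \<subseteq> carrier_vec n" using A cols_dim by blast
  have W: "VectorSpace.subspace class_ring (span (set (cols A))) V" using c by (intro span_is_subspace) auto
  obtain ws where ws: "set ws \<subseteq> carrier_vec n" "span (set ws) = span (set (cols A))"
    "length ws = rank A" using subspace_basis_list[OF W] unfolding rank_def by metis
  have "set (cols A) \<subseteq> span (set ws)" using ws(2) in_own_span c by auto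
  from mat_factor_through_basis[OF A ws(1) this] obtain K where
    "K \<in> carrier_mat (length ws) nc" "A = mat_of_cols n ws * K" by blast
  with ws(3) show thesis by (intro that[of "mat_of_cols n ws" K]) auto
qed

lemma (in vec_space) rank_le_nr:
  assumes A: "A \<in> carrier_mat n nc"
  shows "rank A \<le> n"
proof -
  have c: "set (cols A) \<subseteq> carrier_vec n" using A cols_dim by blast
  have W: "VectorSpace.subspace class_ring (span (set (cols A))) V" using c by (intro span_is_subspace) auto
  show ?thesis
    using subspace_dim[OF W] fin_dim_span_cols[OF A] by (simp add: rank_def dim_is_n)
qed

text \<open>Full row rank makes the columns of \<open>A\<close> span the whole space, so the
  identity factors through them.\<close>

lemma (in vec_space) full_row_rank_right_inverse:
  assumes A: "A \<in> carrier_mat n nc" and r: "n \<le> rank A"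
  obtains H where "H \<in> carrier_mat nc n" and "A * H = 1\<^sub>m n"
proof -
  have c: "set (cols A) \<subseteq> carrier_vec n" using A cols_dim by blast
  have W: "VectorSpace.subspace class_ring (span (set (cols A))) V" using c by (intro span_is_subspace) auto
  obtain ws where ws: "distinct ws" "set ws \<subseteq> carrier_vec n" "lin_indpt (set ws)"
    "span (set ws) = span (set (cols A))"
    "length ws = rank A" using subspace_basis_list[OF W] unfolding rank_def by metis
  have "basis (set ws)"
    using ws r by (intro dim_li_is_basis) (auto simp: dim_is_n distinct_card)
  then have sp: "span (set (cols A)) = carrier_vec n" using ws(4) by (auto simp: basis_def)
  have "set (cols (1\<^sub>m n)) \<subseteq> span (set (cols A))"
    unfolding sp using cols_dim[of "1\<^sub>m n"] by simp
  from mat_factor_through_basis[OF one_carrier_mat c this] obtain H where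
    "H \<in> carrier_mat (length (cols A)) n" "1\<^sub>m n = mat_of_cols n (cols A) * H" by blast
  then show thesis using A by (intro that[of H]) auto
qed

lemma (in vec_space) rank_diff_le:
  assumes A: "A \<in> carrier_mat n nc" and B: "B \<in> carrier_mat n nc"
  shows "rank (A - B) \<le> rank A + rank B"
proof -
  \<comment> \<open>Negation is multiplication by minus the identity from the right, which does not
    raise the rank.\<close>
  have eq: "A - B = A + B * (-1 \<cdot>\<^sub>m 1\<^sub>m nc)" using A B by (auto simp: mult_smult_distrib[OF B one_carrier_mat])
  have "rank (A - B) \<le> rank A + rank (B * (-1 \<cdot>\<^sub>m 1\<^sub>m nc))"
    unfolding eq using A B by (intro rank_subadditive) auto
  also have "\<dots> \<le> rank A + rank B" using rank_mult_le[OF B, of "-1 \<cdot>\<^sub>m 1\<^sub>m nc" nc] by simp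
  finally show ?thesis .
qed

text \<open>A rank factorization \<open>B * K\<close> is a sum of outer products of columns of
  \<open>B\<close> with rows of \<open>K\<close>. If the rank is positive, \<open>A1\<close> is the
  first of them, and the others form a product of inner dimension \<open>rank A - 1\<close>.\<close>

lemma (in vec_space) rank_one_split:
  assumes A: "A \<in> carrier_mat n nc"
  obtains A1 where "A1 \<in> carrier_mat n nc" and "rank A1 \<le> 1" and "rank (A - A1) \<le> rank A - 1"
proof (cases "rank A")
  case 0
  \<comment> \<open>Truncated subtraction makes the bound on the remainder 0 here, so nothing is
    split off.\<close>
  have "A - 0\<^sub>m n nc = A" using A by auto
  then show thesis using 0 rank_0I[of nc] by (intro that[of "0\<^sub>m n nc"]) auto
next
  case (Suc r)
  obtain B K where B: "B \<in> carrier_mat n (Suc r)" and K: "K \<in> carrier_mat (Suc r) nc" and eq: "A = B * K"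
    using rank_factorization[OF A] unfolding Suc by metis
  define A1 where "A1 = mat n nc (\<lambda>(i, j). B $$ (i, 0) * K $$ (0, j))"
  define B' where "B' = mat n r (\<lambda>(i, s). B $$ (i, Suc s))"
  define K' where "K' = mat r nc (\<lambda>(s, j). K $$ (Suc s, j))"
  have A1: "A1 \<in> carrier_mat n nc" by (simp add: A1_def)
  have "rank A1 \<le> 1"
    by (rule rank_le_1_product_entries[OF A1, of "\<lambda>i. B $$ (i, 0)" "\<lambda>j. K $$ (0, j)"]) (auto simp: A1_def)
  moreover have "A - A1 = B' * K'"
  proof (rule eq_matI)
    fix i j assume "i < dim_row (B' * K')" "j < dim_col (B' * K')"
    then have ij: "i < n" "j < nc" by (auto simp: B'_def K'_def)
    then have "A $$ (i, j) = (\<Sum>s = 0..<Suc r. B $$ (i, s) * K $$ (s, j))"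
      using B K by (auto simp: eq scalar_prod_def intro!: sum.cong)
    \<comment> \<open>The term for \<open>s = 0\<close> is split off; the deleted simp rule would
      split off the last one.\<close>
    also have "\<dots> = A1 $$ (i, j) + (\<Sum>s = 0..<r. B $$ (i, Suc s) * K $$ (Suc s, j))"
      using ij by (simp add: sum.atLeast0_lessThan_Suc_shift A1_def del: sum.op_ivl_Suc)
    finally show "(A - A1) $$ (i, j) = (B' * K') $$ (i, j)"
      using ij A1 A by (auto simp: B'_def K'_def scalar_prod_def)
  qed (use A1 in \<open>auto simp: B'_def K'_def\<close>)
  then have "rank (A - A1) \<le> r"
    using rank_mult_le[of B' r K' nc] rank_le_nc[of B' r] by (simp add: B'_def K'_def)
  ultimately show thesis using A1 Suc by (intro that[of A1]) auto
qed

section \<open>Blocks of vectors\<close>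

lemma sum_list_take_add_nth_le:
  fixes ns :: "nat list"
  assumes "i < length ns"
  shows "sum_list (take i ns) + ns ! i \<le> sum_list ns"
proof -
  have "sum_list (take (Suc i) ns) + sum_list (drop (Suc i) ns) = sum_list ns"
    by (metis append_take_drop_id sum_list_append)
  then show ?thesis using assms by (simp add: take_Suc_conv_app_nth)
qed

text \<open>Leading parts are peeled off until the position falls into the current one. This lets
  equality of vectors be checked block by block.\<close>

lemma index_in_block:
  fixes ns :: "nat list"
  assumes "k < sum_list ns"
  obtains i j where "i < length ns" and "j < ns ! i" and "k = sum_list (take i ns) + j"
  using assms
proof (induction ns arbitrary: k thesis)
  case (Cons n ns)
  show ?case
  proof (cases "k < n")
    case True
    then show ?thesis using Cons.prems(1)[of 0 k] by simp
  next
    case False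
    then have "k - n < sum_list ns" using Cons.prems(2) by simp
    then obtain i j where "i < length ns" "j < ns ! i" "k - n = sum_list (take i ns) + j"
      using Cons.IH[of "k - n"] by blast
    then show ?thesis using False Cons.prems(1)[of "Suc i" j] by simp
  qed
qed simp

lemma block_carrier [simp]: "block ns i c \<in> carrier_vec (ns ! i)"
  and dim_block [simp]: "dim_vec (block ns i c) = ns ! i"
  and block_index: "j < ns ! i \<Longrightarrow> block ns i c $ j = c $ (sum_list (take i ns) + j)"
  by (simp_all add: block_def)

lemma block_plus:
  assumes "i < length ns" and "d \<in> carrier_vec (sum_list ns)"
  shows "block ns i (c + d) = block ns i c + block ns i d"
  using assms sum_list_take_add_nth_le[of i ns] by (intro eq_vecI) (auto simp: block_index)

lemma block_minus:
  assumes "i < length ns" and "d \<in> carrier_vec (sum_list ns)"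
  shows "block ns i (c - d) = block ns i c - block ns i d"
  using assms sum_list_take_add_nth_le[of i ns] by (intro eq_vecI) (auto simp: block_index)

lemma block_zero:
  assumes "i < length ns"
  shows "block ns i (0\<^sub>v (sum_list ns)) = 0\<^sub>v (ns ! i)"
  using assms sum_list_take_add_nth_le[of i ns] by (intro eq_vecI) (auto simp: block_index)

lemma eq_vec_blocksI:
  assumes "c \<in> carrier_vec (sum_list ns)" and "d \<in> carrier_vec (sum_list ns)"
    and "\<And>i. i < length ns \<Longrightarrow> block ns i c = block ns i d"
  shows "c = d"
proof (rule eq_vecI)
  fix k assume "k < dim_vec d"
  then have "k < sum_list ns" using assms by simp
  then obtain i j where "i < length ns" "j < ns ! i" "k = sum_list (take i ns) + j"
    by (rule index_in_block)
  then show "c $ k = d $ k" using assms(3)[of i] block_index[of j ns i] by metis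
qed (use assms in auto)

lemma dim_foldr_append_vec: "dim_vec (foldr (@\<^sub>v) ws vNil) = sum_list (map dim_vec ws)"
  by (induction ws) auto

text \<open>Removing the leading piece shifts all offsets by its length. This gives access to the
  single shots of a channel output.\<close>

lemma block_foldr_append_vec:
  assumes "i < length ws"
  shows "block (map dim_vec ws) i (foldr (@\<^sub>v) ws vNil) = ws ! i"
  using assms
proof (induction ws arbitrary: i)
  case (Cons w ws)
  show ?case
  proof (cases i)
    case 0
    then show ?thesis by (auto simp: block_index intro!: eq_vecI)
  next
    case (Suc i')
    then have i': "i' < length ws" using Cons.prems by simp
    have "block (map dim_vec (w # ws)) i (foldr (@\<^sub>v) (w # ws) vNil)
      = block (map dim_vec ws) i' (foldr (@\<^sub>v) ws vNil)"
      using i' sum_list_take_add_nth_le[of i' "map dim_vec ws"] Suc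
      by (intro eq_vecI) (auto simp: block_index dim_foldr_append_vec)
    then show ?thesis using Cons.IH[OF i'] Suc by simp
  qed
qed simp

lemma vec_from_blocks:
  assumes "\<And>i. i < length ns \<Longrightarrow> f i \<in> carrier_vec (ns ! i)"
  obtains c where "c \<in> carrier_vec (sum_list ns)"
    and "\<And>i. i < length ns \<Longrightarrow> block ns i c = f i"
proof -
  let ?ws = "map f [0..<length ns]"
  have dims: "map dim_vec ?ws = ns" using assms by (intro nth_equalityI) auto
  show thesis
    using dim_foldr_append_vec[of ?ws] block_foldr_append_vec[of _ ?ws] unfolding dims
    by (intro that[of "foldr (@\<^sub>v) ?ws vNil"]) (auto intro: carrier_vecI)
qed

lemma
  assumes "length Ps = length ns"
  shows channel_output_carrier: "channel_output emb ns Ps As c e \<in> carrier_vec (sum_list Ps)"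
    and block_channel_output: "i < length ns \<Longrightarrow>
      block Ps i (channel_output emb ns Ps As c e) =
        shot_output emb (As ! i) (block ns i c) (block Ps i e)"
proof -
  let ?ws = "map (\<lambda>i. shot_output emb (As ! i) (block ns i c) (block Ps i e)) [0..<length ns]"
  \<comment> \<open>The output of a shot has the length of its error block, so the pieces have the
    lengths \<open>Ps\<close>.\<close>
  have dims: "map dim_vec ?ws = Ps"
    using assms by (intro nth_equalityI) (auto simp: shot_output_def)
  show "channel_output emb ns Ps As c e \<in> carrier_vec (sum_list Ps)"
    using dim_foldr_append_vec[of ?ws] unfolding dims by (auto simp: channel_output_def intro: carrier_vecI)
  show "block Ps i (channel_output emb ns Ps As c e) =
        shot_output emb (As ! i) (block ns i c) (block Ps i e)" if "i < length ns"
    using block_foldr_append_vec[of i ?ws] that unfolding dims by (simp add: channel_output_def)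
qed

section \<open>Sum-rank weight and error correction\<close>

text \<open>The rows form a basis of \<open>C\<close>; their independence makes the encoding
  injective, so that a message can be recovered from its code word.\<close>

lemma generator_matrix_exists:
  fixes C :: "'k::field vec set"
  assumes "linear_code n C"
  obtains G where "generator_matrix n C G"
    and "\<And>x. x \<in> carrier_vec (code_dim n C) \<Longrightarrow> G\<^sup>T *\<^sub>v x = 0\<^sub>v n \<Longrightarrow> x = 0\<^sub>v (code_dim n C)"
proof -
  interpret V: vec_space "TYPE('k)" n .
  have W: "VectorSpace.subspace class_ring C V.V" using assms by (simp add: linear_code_def)
  from V.subspace_basis_list[OF W] obtain ws where ws: "distinct ws" "set ws \<subseteq> carrier_vec n"
    "V.lin_indpt (set ws)" "V.span (set ws) = C" "length ws = code_dim n C"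
    unfolding code_dim_def by metis
  let ?G = "mat_of_rows n ws"
  have GT: "?G\<^sup>T = mat_of_cols n ws" using transpose_mat_of_rows by blast
  have cols: "cols (mat_of_cols n ws) = ws" using ws(2) by (rule cols_mat_of_cols)
  show thesis
  proof (rule that)
    show "generator_matrix n C ?G"
      using ws(2,4) mat_of_rows_carrier(1)[of n ws]
      by (simp add: generator_matrix_def V.row_space_def ws(5))
  next
    fix x assume x: "x \<in> carrier_vec (code_dim n C)" and "?G\<^sup>T *\<^sub>v x = 0\<^sub>v n"
    then show "x = 0\<^sub>v (code_dim n C)"
      using V.lin_depI[of "mat_of_cols n ws" "code_dim n C" x] ws(1-3) cols
        mat_of_cols_carrier(1)[of n ws] by (auto simp: GT ws(5))
  qed
qed

lemma generator_matrix_mult_mem: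
  assumes "generator_matrix n C G"
  shows "c \<in> C \<longleftrightarrow> (\<exists>x \<in> carrier_vec (code_dim n C). c = G\<^sup>T *\<^sub>v x)"
proof -
  have G: "G \<in> carrier_mat (code_dim n C) n" and C: "vec_space.row_space n G = C"
    using assms by (auto simp: generator_matrix_def)
  have "c \<in> vec_space.row_space n G \<longleftrightarrow> (\<exists>x \<in> carrier_vec (code_dim n C). c = G\<^sup>T *\<^sub>v x)"
    using G unfolding vec_space.row_space_eq[OF G] by auto
  then show ?thesis by (simp only: C)
qed

text \<open>A lower bound of an infimum is a common lower bound. For the zero code the infimum is
  infinite and the condition is vacuous.\<close>

lemma le_d_SR_iff:
  "enat w \<le> d_SR emb bs ns C \<longleftrightarrow>
    (\<forall>c \<in> C. c \<noteq> 0\<^sub>v (sum_list ns) \<longrightarrow> w \<le> wt_SR emb bs ns c)"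
  by (auto simp: d_SR_def le_INF_iff)

lemma coord_mat_carrier [simp]: "coord_mat emb bs c \<in> carrier_mat (length bs) (dim_vec c)"
  by (simp add: coord_mat_def)

lemma block_coord_mat_carrier [simp]:
  "coord_mat emb bs (block ns i c) \<in> carrier_mat (length bs) (ns ! i)"
  by (metis coord_mat_carrier dim_block)

lemma mat_diff_eqI:
  fixes A :: "'a::ab_group_add mat"
  assumes "A \<in> carrier_mat n m" "B \<in> carrier_mat n m" "C \<in> carrier_mat n m" "A = C + B"
  shows "C = A - B"
  using assms by (auto intro!: eq_matI)

section \<open>Coordinate matrices over the ground field\<close>

context
  fixes emb :: "'q::field \<Rightarrow> 'k::field" and bs :: "'k list"
  assumes hom: "field_hom emb" and bas: "ordered_basis emb bs"
begin

lemma shot_output_one: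
  assumes "c \<in> carrier_vec n"
  shows "shot_output emb (1\<^sub>m n) c e = c + e"
proof -
  interpret field_hom emb by (rule hom)
  show ?thesis using assms by (simp add: shot_output_def mat_hom_one)
qed

text \<open>With the identity as transfer matrix, sending \<open>x - y\<close> with error
  \<open>y\<close> yields \<open>x\<close>, so this is a case of
  \<open>coord_mat_shot_output\<close>.\<close>

lemma coord_mat_minus:
  assumes x: "x \<in> carrier_vec n" and y: "y \<in> carrier_vec n"
  shows "coord_mat emb bs (x - y) = coord_mat emb bs x - coord_mat emb bs y"
proof -
  have c: "coord_mat emb bs (x - y) \<in> carrier_mat (length bs) n"
    "coord_mat emb bs x \<in> carrier_mat (length bs) n"
    "coord_mat emb bs y \<in> carrier_mat (length bs) n"
    using x y coord_mat_carrier[of emb bs] by (metis carrier_vecD minus_carrier_vec)+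
  have "shot_output emb (1\<^sub>m n) (x - y) y = x"
    using x y by (subst shot_output_one) auto
  moreover have "coord_mat emb bs (shot_output emb (1\<^sub>m n) (x - y) y)
      = coord_mat emb bs (x - y) * 1\<^sub>m n + coord_mat emb bs y"
    using x y by (intro coord_mat_shot_output[OF hom bas, of _ n n]) auto
  ultimately show ?thesis using c by (intro mat_diff_eqI[of _ "length bs" n]) auto
qed

lemma coord_mat_zero: "coord_mat emb bs (0\<^sub>v n) = 0\<^sub>m (length bs) n"
proof -
  have "coord_mat emb bs (0\<^sub>v n) \<in> carrier_mat (length bs) n"
    using coord_mat_carrier[of emb bs "0\<^sub>v n"] by simp
  note minus_r_inv_mat[OF this]
  moreover have "coord_mat emb bs (0\<^sub>v n - 0\<^sub>v n) = coord_mat emb bs (0\<^sub>v n) - coord_mat emb bs (0\<^sub>v n)"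
    by (rule coord_mat_minus[of _ n]) auto
  moreover have "0\<^sub>v n - 0\<^sub>v n = (0\<^sub>v n :: 'k vec)" by auto
  ultimately show ?thesis by (simp only:)
qed

text \<open>Each column of \<open>M\<close> supplies the coefficients of an entry of
  \<open>v\<close>. This turns matrices found by rank arguments back into vectors.\<close>

lemma coord_mat_surj:
  assumes M: "M \<in> carrier_mat (length bs) n"
  obtains v where "v \<in> carrier_vec n" and "coord_mat emb bs v = M"
proof -
  interpret E: field_hom emb by (rule hom)
  interpret V: Vector_Spaces.vector_space "\<lambda>(a::'q) (x::'k). emb a * x"
    by unfold_locales (simp_all add: algebra_simps E.hom_add E.hom_mult)
  have dist: "distinct bs" and ind: "V.independent (set bs)" and sp: "V.span (set bs) = UNIV"
    using bas unfolding ordered_basis_def by auto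
  let ?R = "V.representation (set bs)"
  define v where "v = vec n (\<lambda>j. \<Sum>s<length bs. emb (M $$ (s, j)) * bs ! s)"
  have "?R (v $ j) (bs ! i) = M $$ (i, j)" if i: "i < length bs" and j: "j < n" for i j
  proof -
    have "?R (v $ j) (bs ! i) = (\<Sum>s<length bs. M $$ (s, j) * ?R (bs ! s) (bs ! i))"
      using j by (simp add: v_def V.representation_sum[OF ind] V.representation_scale[OF ind] sp)
    \<comment> \<open>\<open>bs\<close> has no repetitions, so \<open>bs ! s = bs ! i\<close> only
      for \<open>s = i\<close>.\<close>
    also have "\<dots> = (\<Sum>s<length bs. if s = i then M $$ (s, j) else 0)"
      using i dist by (intro sum.cong) (auto simp: V.representation_basis[OF ind] nth_eq_iff_index_eq)
    finally show ?thesis using i by simp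
  qed
  then have "coord_mat emb bs v = M" using M by (intro eq_matI) (auto simp: coord_mat_def v_def)
  then show thesis by (intro that[of v]) (auto simp: v_def)
qed

section \<open>Triangle inequality and splitting of the sum-rank weight\<close>

lemma wt_SR_zero: "wt_SR emb bs ns (0\<^sub>v (sum_list ns)) = 0"
  by (simp add: wt_SR_def block_zero coord_mat_zero vec_space.rank_0I)

lemma wt_SR_minus_le:
  assumes "c \<in> carrier_vec (sum_list ns)" and "d \<in> carrier_vec (sum_list ns)"
  shows "wt_SR emb bs ns (c - d) \<le> wt_SR emb bs ns c + wt_SR emb bs ns d"
  unfolding wt_SR_def sum.distrib[symmetric]
proof (rule sum_mono)
  fix i assume "i \<in> {..<length ns}"
  then show "vec_space.rank (length bs) (coord_mat emb bs (block ns i (c - d)))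
    \<le> vec_space.rank (length bs) (coord_mat emb bs (block ns i c))
      + vec_space.rank (length bs) (coord_mat emb bs (block ns i d))"
    using assms vec_space.rank_diff_le[OF block_coord_mat_carrier[of emb bs ns i c]
        block_coord_mat_carrier[of emb bs ns i d]]
    by (simp add: block_minus coord_mat_minus[of _ "ns ! i"])
qed

text \<open>If the weight is positive, one unit of rank is removed from a single block of nonzero
  rank; all other blocks of \<open>a\<close> are zero.\<close>

lemma wt_SR_one_split:
  assumes c: "c \<in> carrier_vec (sum_list ns)"
  obtains a where "a \<in> carrier_vec (sum_list ns)" and "wt_SR emb bs ns a \<le> 1"
    and "wt_SR emb bs ns (c - a) \<le> wt_SR emb bs ns c - 1"
proof (cases "wt_SR emb bs ns c = 0")
  case True
  then show thesis using c wt_SR_zero[of ns] by (intro that[of "0\<^sub>v (sum_list ns)"]) auto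
next
  case False
  let ?M = "\<lambda>c i. coord_mat emb bs (block ns i c)"
  let ?r = "\<lambda>c i. vec_space.rank (length bs) (?M c i)"
  obtain i where i: "i < length ns" and ri: "?r c i \<noteq> 0"
    using False by (auto simp: wt_SR_def)
  obtain A where A: "A \<in> carrier_mat (length bs) (ns ! i)"
    "vec_space.rank (length bs) A \<le> 1" "vec_space.rank (length bs) (?M c i - A) \<le> ?r c i - 1"
    using vec_space.rank_one_split[OF block_coord_mat_carrier[of emb bs ns i c]] by metis
  obtain v where v: "v \<in> carrier_vec (ns ! i)" "coord_mat emb bs v = A"
    using coord_mat_surj[OF A(1)] .
  have "(if j = i then v else 0\<^sub>v (ns ! j)) \<in> carrier_vec (ns ! j)" for j using v by simp
  from vec_from_blocks[OF this] obtain a where a: "a \<in> carrier_vec (sum_list ns)"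
    and ba: "\<And>j. j < length ns \<Longrightarrow> block ns j a = (if j = i then v else 0\<^sub>v (ns ! j))"
    by blast
  have "wt_SR emb bs ns a = ?r a i + (\<Sum>j\<in>{..<length ns} - {i}. ?r a j)"
    unfolding wt_SR_def using i by (intro sum.remove) auto
  also have "(\<Sum>j\<in>{..<length ns} - {i}. ?r a j) = 0"
    using ba by (intro sum.neutral) (auto simp: coord_mat_zero vec_space.rank_0I)
  also have "?r a i \<le> 1" using ba[OF i] v A by simp
  finally have wa: "wt_SR emb bs ns a \<le> 1" by simp
  have bca: "block ns j (c - a) = block ns j c - block ns j a" if "j < length ns" for j
    using that a by (rule block_minus)
  have "wt_SR emb bs ns (c - a) = ?r (c - a) i + (\<Sum>j\<in>{..<length ns} - {i}. ?r (c - a) j)"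
    unfolding wt_SR_def using i by (intro sum.remove) auto
  also have "(\<Sum>j\<in>{..<length ns} - {i}. ?r (c - a) j) = (\<Sum>j\<in>{..<length ns} - {i}. ?r c j)"
  proof (intro sum.cong refl)
    fix j assume j: "j \<in> {..<length ns} - {i}"
    then have "block ns j (c - a) = block ns j c"
      using ba[of j] by (intro eq_vecI) (auto simp: bca)
    then show "?r (c - a) j = ?r c j" by simp
  qed
  also have "?r (c - a) i \<le> ?r c i - 1"
    using A v ba[OF i] i by (simp add: bca coord_mat_minus[of _ "ns ! i"])
  \<comment> \<open>The chosen block has positive rank, so the truncated subtraction in it lowers
    the whole sum by exactly 1.\<close>
  also have "?r c i - 1 + (\<Sum>j\<in>{..<length ns} - {i}. ?r c j) = wt_SR emb bs ns c - 1"
  proof -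
    have "wt_SR emb bs ns c = ?r c i + (\<Sum>j\<in>{..<length ns} - {i}. ?r c j)"
      unfolding wt_SR_def using i by (intro sum.remove) auto
    then show ?thesis using ri by simp
  qed
  finally show thesis using a wa that by simp
qed

text \<open>Units of weight are split off one at a time, \<open>t\<close> times; once the weight is
  used up, the truncated difference stays 0.\<close>

lemma wt_SR_split:
  assumes c: "c \<in> carrier_vec (sum_list ns)"
  obtains a where "a \<in> carrier_vec (sum_list ns)" and "wt_SR emb bs ns a \<le> t"
    and "wt_SR emb bs ns (c - a) \<le> wt_SR emb bs ns c - t"
proof -
  have "\<exists>a \<in> carrier_vec (sum_list ns). wt_SR emb bs ns a \<le> t
    \<and> wt_SR emb bs ns (c - a) \<le> wt_SR emb bs ns c - t"
  proof (induction t)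
    case 0
    have "c - 0\<^sub>v (sum_list ns) = c" using c by auto
    then show ?case using wt_SR_zero[of ns] by (intro bexI[of _ "0\<^sub>v (sum_list ns)"]) auto
  next
    case (Suc t)
    then obtain a where a: "a \<in> carrier_vec (sum_list ns)" "wt_SR emb bs ns a \<le> t"
      "wt_SR emb bs ns (c - a) \<le> wt_SR emb bs ns c - t" by blast
    obtain b where b: "b \<in> carrier_vec (sum_list ns)" "wt_SR emb bs ns b \<le> 1"
      "wt_SR emb bs ns (c - a - b) \<le> wt_SR emb bs ns (c - a) - 1"
      using wt_SR_one_split[OF minus_carrier_vec[OF c a(1)]] by metis
    \<comment> \<open>The summand \<open>b\<close> is negated in order to bound \<open>a + b\<close>
      by the triangle inequality for differences.\<close>
    have "wt_SR emb bs ns (0\<^sub>v (sum_list ns) - b) \<le> 1"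
      using wt_SR_minus_le[of "0\<^sub>v (sum_list ns)" ns b] b wt_SR_zero[of ns] by simp
    moreover have "a - (0\<^sub>v (sum_list ns) - b) = a + b" using a b by auto
    ultimately have "wt_SR emb bs ns (a + b) \<le> Suc t"
      using wt_SR_minus_le[of a ns "0\<^sub>v (sum_list ns) - b"] a b by simp
    moreover have "c - (a + b) = c - a - b" using a b c by auto
    ultimately show ?case using a b by (intro bexI[of _ "a + b"]) auto
  qed
  then show thesis using that by blast
qed

section \<open>Inputs with equal channel outputs\<close>

lemma shot_output_minus:
  assumes A: "A \<in> carrier_mat n P"
    and "c \<in> carrier_vec n" "c' \<in> carrier_vec n" "e \<in> carrier_vec P" "e' \<in> carrier_vec P"
    and eq: "shot_output emb A c e = shot_output emb A c' e'"
  shows "shot_output emb A (c - c') (0\<^sub>v P) = e' - e"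
proof -
  let ?B = "(map_mat emb A)\<^sup>T"
  have B: "?B \<in> carrier_mat P n" using A by simp
  have "?B *\<^sub>v (c - c') = ?B *\<^sub>v c - ?B *\<^sub>v c'"
    using B assms by (intro mult_minus_distrib_mat_vec) auto
  moreover have "?B *\<^sub>v c - ?B *\<^sub>v c' = e' - e"
  proof (rule eq_vecI)
    fix j assume "j < dim_vec (e' - e)"
    then have j: "j < P" using assms by simp
    have "(?B *\<^sub>v c + e) $ j = (?B *\<^sub>v c' + e') $ j" using eq by (simp add: shot_output_def)
    then show "(?B *\<^sub>v c - ?B *\<^sub>v c') $ j = (e' - e) $ j"
      using j assms B by (simp add: algebra_simps del: index_mult_mat_vec)
  qed (use assms in auto)
  ultimately show ?thesis using assms B by (simp add: shot_output_def)
qed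

text \<open>A full-row-rank transfer matrix has a right inverse, so it does not lower the rank of the
  transmitted block.\<close>

lemma wt_SR_le_if_channel_output_eq:
  assumes len: "length Ps = length ns"
    and As: "\<And>i. i < length ns \<Longrightarrow> As ! i \<in> carrier_mat (ns ! i) (Ps ! i)"
    and rk: "sum_list ns \<le> (\<Sum>i<length ns. vec_space.rank (ns ! i) (As ! i))"
    and c: "c \<in> carrier_vec (sum_list ns)" "c' \<in> carrier_vec (sum_list ns)"
    and e: "e \<in> carrier_vec (sum_list Ps)" "e' \<in> carrier_vec (sum_list Ps)"
    and eq: "channel_output emb ns Ps As c e = channel_output emb ns Ps As c' e'"
  shows "wt_SR emb bs ns (c - c') \<le> wt_SR emb bs Ps (e' - e)"
proof -
  have "sum_list ns = (\<Sum>i<length ns. ns ! i)" by (simp add: sum_list_sum_nth atLeast0LessThan)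
  \<comment> \<open>No rank exceeds \<open>ns ! i\<close>, and the ranks add up to at least the
    total length, so each of them attains its maximum.\<close>
  have full: "ns ! i \<le> vec_space.rank (ns ! i) (As ! i)" if "i < length ns" for i
  proof (rule ccontr)
    assume "\<not> ?thesis"
    moreover have "vec_space.rank (ns ! j) (As ! j) \<le> ns ! j" if "j < length ns" for j
      using vec_space.rank_le_nr[OF As[OF that]] .
    ultimately have "(\<Sum>i<length ns. vec_space.rank (ns ! i) (As ! i)) < (\<Sum>i<length ns. ns ! i)"
      using that by (intro sum_strict_mono_ex1) (auto intro!: bexI[of _ i])
    then show False using rk \<open>sum_list ns = _\<close> by simp
  qed
  have "vec_space.rank (length bs) (coord_mat emb bs (block ns i (c - c')))
    \<le> vec_space.rank (length bs) (coord_mat emb bs (block Ps i (e' - e)))" if i: "i < length ns" for i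
  proof -
    let ?M = "coord_mat emb bs (block ns i (c - c'))"
    obtain H where H: "H \<in> carrier_mat (Ps ! i) (ns ! i)" "As ! i * H = 1\<^sub>m (ns ! i)"
      using vec_space.full_row_rank_right_inverse[OF As[OF i] full[OF i]] .
    have "shot_output emb (As ! i) (block ns i c) (block Ps i e)
        = shot_output emb (As ! i) (block ns i c') (block Ps i e')"
      using eq len i by (metis block_channel_output)
    \<comment> \<open>The difference of the two blocks, sent without error, comes out as the
      difference of the errors.\<close>
    from shot_output_minus[OF As[OF i] _ _ _ _ this]
    have "shot_output emb (As ! i) (block ns i (c - c')) (0\<^sub>v (Ps ! i)) = block Ps i (e' - e)"
      using c e len i by (simp add: block_minus)
    then have "coord_mat emb bs (block Ps i (e' - e)) = ?M * As ! i + 0\<^sub>m (length bs) (Ps ! i)"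
      using coord_mat_shot_output[OF hom bas As[OF i] block_carrier zero_carrier_vec, of "c - c'"]
      by (simp add: coord_mat_zero)
    also have "\<dots> = ?M * As ! i"
      by (rule right_add_zero_mat[OF mult_carrier_mat[OF block_coord_mat_carrier As[OF i]]])
    finally have "?M * As ! i = coord_mat emb bs (block Ps i (e' - e))" ..
    \<comment> \<open>The right inverse undoes the transfer matrix, and multiplication by
      \<open>H\<close> cannot raise the rank of the error matrix.\<close>
    then have "?M = coord_mat emb bs (block Ps i (e' - e)) * H"
      using assoc_mult_mat[OF block_coord_mat_carrier As[OF i] H(1)] H(2)
        right_mult_one_mat[OF block_coord_mat_carrier] by metis
    then show ?thesis using vec_space.rank_mult_le[OF block_coord_mat_carrier H(1)] by metis
  qed
  then show ?thesis using len unfolding wt_SR_def by (auto intro!: sum_mono)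
qed

end

section \<open>Equivalence of error correction and minimum distance\<close>

theorem coherently_corrects_errors_iff:
  fixes emb :: "'q::field \<Rightarrow> 'k::field" and C :: "'k vec set"
  assumes hom: "field_hom emb" and bas: "ordered_basis emb bs"
    and lin: "linear_code (sum_list ns) C" and pos: "\<And>i. i < length ns \<Longrightarrow> ns ! i > 0"
  shows "coherently_corrects emb bs ns C t 0 \<longleftrightarrow> enat (2 * t + 1) \<le> d_SR emb bs ns C"
proof
  let ?n = "sum_list ns" and ?k = "code_dim (sum_list ns) C"
  have C: "C \<subseteq> carrier_vec ?n"
    using lin submodule.subset[of class_ring C "module_vec TYPE('k) ?n"]
    by (simp add: linear_code_def VectorSpace.subspace_def module_vec_simps)
  {
    assume d: "enat (2 * t + 1) \<le> d_SR emb bs ns C"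
    \<comment> \<open>The decoder must return the message and not only the code word, hence the
      choice of a generator matrix with injective encoding.\<close>
    obtain G where G: "generator_matrix ?n C G"
      and inj: "\<And>x. x \<in> carrier_vec ?k \<Longrightarrow> G\<^sup>T *\<^sub>v x = 0\<^sub>v ?n \<Longrightarrow> x = 0\<^sub>v ?k"
      using generator_matrix_exists[OF lin] by blast
    have GT: "G\<^sup>T \<in> carrier_mat ?n ?k" using G by (simp add: generator_matrix_def)
    show "coherently_corrects emb bs ns C t 0"
      unfolding coherently_corrects_def Let_def
    proof (intro exI[of _ G] conjI G allI impI)
      fix Ps :: "nat list" and As :: "'q mat list"
      assume "length Ps = length ns \<and> length As = length ns \<and>
        (\<forall>i<length ns. Ps ! i > 0 \<and> As ! i \<in> carrier_mat (ns ! i) (Ps ! i)) \<and>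
        (\<Sum>i<length ns. vec_space.rank (ns ! i) (As ! i)) \<ge> ?n - 0"
      then have len: "length Ps = length ns"
        and As: "\<And>i. i < length ns \<Longrightarrow> As ! i \<in> carrier_mat (ns ! i) (Ps ! i)"
        and rk: "?n \<le> (\<Sum>i<length ns. vec_space.rank (ns ! i) (As ! i))" by simp_all
      \<comment> \<open>The decoder will be a selector for this relation, once it is known to
        determine \<open>x\<close> from \<open>y\<close>.\<close>
      define P where "P = (\<lambda>x y. x \<in> carrier_vec ?k \<and> (\<exists>e \<in> carrier_vec (sum_list Ps).
        wt_SR emb bs Ps e \<le> t \<and> channel_output emb ns Ps As (G\<^sup>T *\<^sub>v x) e = y))"
      have uniq: "x = x'" if P: "P x y" "P x' y" for x x' y
      proof -
        have x: "x \<in> carrier_vec ?k" "x' \<in> carrier_vec ?k" using P by (simp_all add: P_def)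
        from P(1) obtain e where e: "e \<in> carrier_vec (sum_list Ps)" "wt_SR emb bs Ps e \<le> t"
          "channel_output emb ns Ps As (G\<^sup>T *\<^sub>v x) e = y" by (auto simp: P_def)
        from P(2) obtain e' where e': "e' \<in> carrier_vec (sum_list Ps)" "wt_SR emb bs Ps e' \<le> t"
          "channel_output emb ns Ps As (G\<^sup>T *\<^sub>v x') e' = y" by (auto simp: P_def)
        have eq: "channel_output emb ns Ps As (G\<^sup>T *\<^sub>v x) e =
            channel_output emb ns Ps As (G\<^sup>T *\<^sub>v x') e'" using e(3) e'(3) by simp
        have dx: "x - x' \<in> carrier_vec ?k" using x by simp
        have c: "G\<^sup>T *\<^sub>v x \<in> carrier_vec ?n" "G\<^sup>T *\<^sub>v x' \<in> carrier_vec ?n" using GT x by auto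
        have diff: "G\<^sup>T *\<^sub>v (x - x') = G\<^sup>T *\<^sub>v x - G\<^sup>T *\<^sub>v x'"
          using GT x by (rule mult_minus_distrib_mat_vec)
        have "wt_SR emb bs ns (G\<^sup>T *\<^sub>v (x - x')) \<le> wt_SR emb bs Ps (e' - e)"
          unfolding diff
          by (rule wt_SR_le_if_channel_output_eq[OF hom bas len As rk c e(1) e'(1) eq])
        also have "\<dots> \<le> 2 * t" using wt_SR_minus_le[OF hom bas e'(1) e(1)] e(2) e'(2) by simp
        finally have "\<not> 2 * t + 1 \<le> wt_SR emb bs ns (G\<^sup>T *\<^sub>v (x - x'))" by simp
        moreover have "G\<^sup>T *\<^sub>v (x - x') \<in> C"
          using generator_matrix_mult_mem[OF G] dx by blast
        \<comment> \<open>A code word lighter than the minimum distance is zero; injectivity of the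
          encoding passes this on to the messages.\<close>
        ultimately have "G\<^sup>T *\<^sub>v (x - x') = 0\<^sub>v ?n" using d le_d_SR_iff by blast
        then have 0: "x - x' = 0\<^sub>v ?k" by (rule inj[OF dx])
        show "x = x'"
        proof (rule eq_vecI)
          fix i assume "i < dim_vec x'"
          then show "x $ i = x' $ i"
            using x arg_cong[OF 0, of "\<lambda>v. v $ i"] by auto
        qed (use x in auto)
      qed
      \<comment> \<open>Outputs that no message explains go to the zero message, which keeps the
        values of \<open>D\<close> in the message space.\<close>
      define D where "D y = (if \<exists>x. P x y then SOME x. P x y else 0\<^sub>v ?k)" for y
      have D: "D y = x" if "P x y" for x y
        using that uniq unfolding D_def by (metis someI_ex)
      show "\<exists>D \<in> carrier_vec (sum_list Ps) \<rightarrow> carrier_vec ?k.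
          \<forall>x \<in> carrier_vec ?k. \<forall>e \<in> carrier_vec (sum_list Ps). wt_SR emb bs Ps e \<le> t \<longrightarrow>
            D (channel_output emb ns Ps As (G\<^sup>T *\<^sub>v x) e) = x"
      proof (intro bexI[of _ D] ballI impI)
        fix x :: "'k vec" and e
        assume "x \<in> carrier_vec ?k" "e \<in> carrier_vec (sum_list Ps)" "wt_SR emb bs Ps e \<le> t"
        then show "D (channel_output emb ns Ps As (G\<^sup>T *\<^sub>v x) e) = x"
          by (intro D) (auto simp: P_def)
      next
        show "D \<in> carrier_vec (sum_list Ps) \<rightarrow> carrier_vec ?k"
        proof
          fix y
          show "D y \<in> carrier_vec ?k"
          proof (cases "\<exists>x. P x y")
            case True
            then show ?thesis using D by (metis P_def)
          qed (simp add: D_def)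
        qed
      qed
    qed
  next
    assume "coherently_corrects emb bs ns C t 0"
    then obtain G where G: "generator_matrix ?n C G"
      and corr: "\<And>Ps As. length Ps = length ns \<and> length As = length ns \<and>
            (\<forall>i<length ns. Ps ! i > 0 \<and> As ! i \<in> carrier_mat (ns ! i) (Ps ! i)) \<and>
            (\<Sum>i<length ns. vec_space.rank (ns ! i) (As ! i)) \<ge> ?n - 0 \<Longrightarrow>
          (\<exists>D \<in> carrier_vec (sum_list Ps) \<rightarrow> carrier_vec ?k.
            \<forall>x \<in> carrier_vec ?k. \<forall>e \<in> carrier_vec (sum_list Ps).
              wt_SR emb bs Ps e \<le> t \<longrightarrow>
              D (channel_output emb ns Ps As (G\<^sup>T *\<^sub>v x) e) = x)"
      unfolding coherently_corrects_def Let_def by blast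
    have GT: "G\<^sup>T \<in> carrier_mat ?n ?k" using G by (simp add: generator_matrix_def)
    \<comment> \<open>Identity matrices have full rank and keep the length of each shot, so
      \<open>Ps\<close> is \<open>ns\<close>; its parts are positive, which makes this channel
      admissible.\<close>
    let ?As = "map one_mat ns :: 'q mat list"
    have "vec_space.rank i (1\<^sub>m i :: 'q mat) = i" for i
      by (intro vec_space.low_rank_det_zero) auto
    then have "(\<Sum>i<length ns. vec_space.rank (ns ! i) (?As ! i)) = ?n"
      by (simp add: sum_list_sum_nth atLeast0LessThan)
    then have "\<exists>D \<in> carrier_vec ?n \<rightarrow> carrier_vec ?k. \<forall>x \<in> carrier_vec ?k. \<forall>e \<in> carrier_vec ?n.
        wt_SR emb bs ns e \<le> t \<longrightarrow> D (channel_output emb ns ns ?As (G\<^sup>T *\<^sub>v x) e) = x"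
      using pos by (intro corr) simp
    then obtain D where D: "\<And>x e. x \<in> carrier_vec ?k \<Longrightarrow> e \<in> carrier_vec ?n \<Longrightarrow>
        wt_SR emb bs ns e \<le> t \<Longrightarrow> D (channel_output emb ns ns ?As (G\<^sup>T *\<^sub>v x) e) = x"
      by blast
    have out: "channel_output emb ns ns ?As c e = c + e"
      if "c \<in> carrier_vec ?n" "e \<in> carrier_vec ?n" for c e
    proof (rule eq_vec_blocksI[of _ ns])
      fix i assume i: "i < length ns"
      show "block ns i (channel_output emb ns ns ?As c e) = block ns i (c + e)"
        using i that shot_output_one[OF hom bas block_carrier]
        by (simp add: block_channel_output block_plus)
    qed (use that in \<open>auto intro: channel_output_carrier\<close>)
    show "enat (2 * t + 1) \<le> d_SR emb bs ns C"
      unfolding le_d_SR_iff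
    proof (intro ballI impI)
      fix c assume cC: "c \<in> C" and c0: "c \<noteq> 0\<^sub>v ?n"
      have c: "c \<in> carrier_vec ?n" using cC C by blast
      show "2 * t + 1 \<le> wt_SR emb bs ns c"
      proof (rule ccontr)
        assume small: "\<not> 2 * t + 1 \<le> wt_SR emb bs ns c"
        \<comment> \<open>The weight of \<open>c\<close> is at most \<open>2 * t\<close>, so
          splitting off \<open>t\<close> leaves a remainder \<open>c - a\<close> of weight at most
          \<open>t\<close>.\<close>
        obtain a where a: "a \<in> carrier_vec ?n" "wt_SR emb bs ns a \<le> t"
          and wa: "wt_SR emb bs ns (c - a) \<le> wt_SR emb bs ns c - t"
          using wt_SR_split[OF hom bas c, of t] .
        let ?z = "0\<^sub>v ?n :: 'k vec"
        \<comment> \<open>The negated remainder is the error that takes \<open>c\<close> to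
          \<open>a\<close>; the zero code word reaches the same output with error
          \<open>a\<close>.\<close>
        have e: "?z - (c - a) \<in> carrier_vec ?n" using a c by auto
        have we: "wt_SR emb bs ns (?z - (c - a)) \<le> t"
          using wt_SR_minus_le[OF hom bas, of ?z ns "c - a"] wt_SR_zero[OF hom bas, of ns] a c wa small
          by simp
        obtain x where x: "x \<in> carrier_vec ?k" "c = G\<^sup>T *\<^sub>v x"
          using cC generator_matrix_mult_mem[OF G] by blast
        have z: "G\<^sup>T *\<^sub>v 0\<^sub>v ?k = ?z" using GT by auto
        have "c + (?z - (c - a)) = ?z + a" using a c by auto
        then have "channel_output emb ns ns ?As (G\<^sup>T *\<^sub>v x) (?z - (c - a))
            = channel_output emb ns ns ?As (G\<^sup>T *\<^sub>v 0\<^sub>v ?k) a"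
          using out[OF c e] out[of ?z a] a by (simp add: z flip: x(2))
        \<comment> \<open>The decoder has to return both messages for the common output.\<close>
        then have "x = 0\<^sub>v ?k" using D[OF x(1) e we] D[OF _ a(1,2), of "0\<^sub>v ?k"] by simp
        then show False using x z c0 by simp
      qed
    qed
  }
qed

theorem theorem8:
  fixes emb :: "'q::{field,finite} \<Rightarrow> 'k::{field,finite}"
    and bs :: "'k list"
    and m N l r :: nat
    and C :: "'k vec set"
  assumes "field_hom emb"
    and "ordered_basis emb bs" and "length bs = m" and "m \<ge> 1"
    and "N \<ge> 1" and "l \<ge> 1"
    and "proper_SR_Hamming emb bs N r l C"
  shows "linear_code (l * N) C \<and> redundancy (l * N) C = r \<and>
    coherently_corrects emb bs (replicate l N) C 1 0 \<and>
    \<not> (\<exists>l' C'. l' > l \<and> linear_code (l' * N) C' \<and> redundancy (l' * N) C' = r \<and>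
         coherently_corrects emb bs (replicate l' N) C' 1 0)"
proof -
  \<comment> \<open>For \<open>t = 1\<close> the bound \<open>2 * t + 1\<close> is 3. The
    equivalence is stated for every \<open>l'\<close> because maximality compares \<open>C\<close>
    with codes for all larger numbers of shots.\<close>
  have "coherently_corrects emb bs (replicate l' N) C' 1 0 \<longleftrightarrow> 3 \<le> d_SR emb bs (replicate l' N) C'"
    if "linear_code (l' * N) C'" for l' and C' :: "'k vec set"
    using coherently_corrects_errors_iff[OF assms(1,2), of "replicate l' N" C' 1] that \<open>N \<ge> 1\<close>
    by (simp add: sum_list_replicate numeral_eq_enat)
  then show ?thesis using assms(7) unfolding proper_SR_Hamming_def by metis
qed

end
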